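(* Let $(P)$, $(D)$ be the statistical constrained learning problem and its augmented dual, and $(\hat P)$, $(\hat D)$ the empirical problem and its augmented dual, as defined in the context. Assume: (1) (Bounded objective) the function $\ell_0$ (that is, $\theta\mapsto\ell_0(f_\theta)$) is bounded below. (2) (Closed domain) the set $\Theta\subseteq\mathbb{R}^p$ is closed (e.g. $\Theta=\mathbb{R}^p$). (3) (Continuity) the mapping $\theta\mapsto f_\theta$ is continuous, and the sample-wise losses $\bar\ell_i(\cdot,y)$ are continuous and uniformly bounded in $y$. (4) (Compact feasible level set) there exist $u>0$ and $\bar p>\inf(P)$ such that the set $\{\theta\in\Theta:\ \ell_0(f_\theta)\le\bar p,\ \ell_i(f_\theta)\le u\ \ \forall i=1,\dots,m\}$ is compact. (5) (Linear independence constraint qualification, LICQ) problem $(P)$ satisfies LICQ: the set of gradients $\nabla_\theta\ell_i(f_{\theta^*})$ of the active constraints (those $i\in\{1,\dots,m\}$ with $\ell_i(f_{\theta^*})=0$) is linearly independent at the optimal point $\theta^*$ of $(P)$. (6) (Smoothness) each function $\theta\mapsto\ell_i(f_\theta)$, $i=0,\dots,m$, is twice continuously differentiable. (7) (Second-order sufficient condition) let $\bar\theta\in\Theta$ and $\bar\lambda\in\mathbb{R}^m$ with $\bar\lambda_i\ge0$ for all $i$ be such that the KKT conditions of $(P)$ hold at $(\bar\theta,\bar\lambda)$ (such a pair exists if (5) holds). Put $$H:=\nabla^2_\theta\Big[\ell_0(f_\theta)+\sum_{i=1}^m\bar\lambda_i\,\ell_i(f_\theta)\Big]_{\theta=\bar\theta},\quad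 I_0:=\{i:\ell_i(f_{\bar\theta})=0,\ \bar\lambda_i>0\},\quad I_1:=\{i:\ell_i(f_{\bar\theta})=0,\ \bar\lambda_i=0\}.$$ Then $z^\top Hz>0$ for all nonzero $z\in C(\bar\theta)$, where $$C(\bar\theta)=\big\{z\in\mathbb{R}^p:\ \nabla_\theta\ell_i(f_{\bar\theta})^\top z=0\ \text{for } i\in I_0,\ \ \nabla_\theta\ell_i(f_{\bar\theta})^\top z\le0\ \text{for } i\in I_1\big\}.$$ (8) (Uniform convergence) for each $i=0,\dots,m$ there exists $\zeta_i(N,\delta)\ge0$, monotonically decreasing in $N$, such that $|\ell_i(f_\theta)-\hat\ell_i(f_\theta)|\le\zeta_i(N,\delta)$ for all $\theta\in\Theta$, with probability $1-\delta$ over $N$ i.i.d. samples $(x_n,y_n)\sim\mathcal{D}_i$. (9) (Empirical strong duality) $\inf(\hat P)=\sup(\hat D)$, and $\sup(\hat D)$ is attained by some pair in $T$. Let $(\lambda^*,\alpha^* )$ be a solution of $(D)$, let $(\hat\lambda^\star,\hat\alpha^\star)$ be a solution of $(\hat D)$, and let $\hat\theta^\star$ be a solution of $(\hat P)$. Then $$\hat\theta^\star\in\arg\min_{\theta\in\Theta}\hat L(\theta,\hat\lambda^\star,\hat\alpha^\star),$$ and, with probability $1-(2m+1)\delta$, $$|P^\star-\ell_0(f_{\hat\theta^\star})|\le(2+\Delta_\lambda)\bar\zeta+\Delta_\alpha m\bar\zeta^2,$$ $$\ell_i(f_{\hat\theta^\star})\le\zeta_i(N_i,\delta)\quad\text{for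 all } i=1,\dots,m,$$ where $P^\star$ is the optimal value of $(P)$, $\bar\zeta=\max_i\zeta_i(N_i,\delta)$ (maximum over $i=0,\dots,m$), $\Delta_\lambda=\max(\|\lambda^*\|_1,\|\hat\lambda^\star\|_1)$ and $\Delta_\alpha=\max(\alpha^*,\hat\alpha^\star)$.
   Context: Setting. $\Theta\subseteq\mathbb{R}^p$ is a parameter set, and for each $\theta\in\Theta$, $f_\theta:\mathcal{X}\to\mathcal{Y}$ is a parametrized function. For $i=0,1,\dots,m$, $\mathcal{D}_i$ is a probability distribution of pairs $(x,y)$, $\bar\ell_i(\cdot,\cdot)$ is a real-valued sample-wise loss, and the risk functional is $$\ell_i(f_\theta):=\mathbb{E}_{(x,y)\sim\mathcal{D}_i}\big[\bar\ell_i(f_\theta(x),y)\big].$$ For each $i$ there are $N_i$ i.i.d. samples $(x_n,y_n)\sim\mathcal{D}_i$, and the empirical risk is $\hat\ell_i(f_\theta):=\frac1{N_i}\sum_{n=1}^{N_i}\bar\ell_i(f_\theta(x_n),y_n)$. Probabilities refer to the draw of the samples; "with probability $q$" is meant in the usual sense of probability at least $q$. Primal problem $(P)$: minimize $\ell_0(f_\theta)$ over $\theta\in\Theta$ subject to $\ell_i(f_\theta)\le 0$, $i=1,\dots,m$; optimal value $\inf(P)$. Empirical primal problem $(\hat P)$: minimize $\hat\ell_0(f_\theta)$ over $\theta\in\Theta$ subject to $\hat\ell_i(f_\theta)\le 0$, $i=1,\dots,m$; optimal value $\inf(\hat P)$. KKT conditions of $(P)$ at $(\bar\theta,\bar\lambda)$: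 $\nabla_\theta\ell_0(f_{\bar\theta})+\sum_{i=1}^m\bar\lambda_i\nabla_\theta\ell_i(f_{\bar\theta})=0$, and for all $i=1,\dots,m$: $\ell_i(f_{\bar\theta})\le0$, $\bar\lambda_i\ge0$, $\bar\lambda_i\,\ell_i(f_{\bar\theta})=0$. Augmented Lagrangians: with $\Psi(x,y)=\frac{(\max\{0,2x+y\})^2-y^2}{4}$ and $(\lambda,\alpha)\in T=\mathbb{R}^m\times(0,+\infty)$, $$L(\theta,\lambda,\alpha)=\ell_0(f_\theta)+\alpha\sum_{i=1}^m\Psi\Big(\ell_i(f_\theta),\frac{\lambda_i}{\alpha}\Big),\qquad \hat L(\theta,\lambda,\alpha)=\hat\ell_0(f_\theta)+\alpha\sum_{i=1}^m\Psi\Big(\hat\ell_i(f_\theta),\frac{\lambda_i}{\alpha}\Big).$$ Augmented dual problems: $(D)$ is to maximize $g(\lambda,\alpha):=\inf_{\theta\in\Theta}L(\theta,\lambda,\alpha)$ over $(\lambda,\alpha)\in T$, with value $\sup(D)$; $(\hat D)$ is to maximize $\hat g(\lambda,\alpha):=\inf_{\theta\in\Theta}\hat L(\theta,\lambda,\alpha)$ over $(\lambda,\alpha)\in T$, with value $\sup(\hat D)$. A solution of any of these problems is a (feasible) point attaining its optimal value. *)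

theory Defs
  imports "HOL-Probability.Probability"
begin

section \<open>Risks\<close>

definition risk ::
  "('x \<times> 'y) measure \<Rightarrow> ('y \<Rightarrow> 'y \<Rightarrow> real) \<Rightarrow> ('x \<Rightarrow> 'y) \<Rightarrow> real" where
  "risk D loss h = (\<integral>z. loss (h (fst z)) (snd z) \<partial>D)"

definition empirical_risk ::
  "nat \<Rightarrow> ('y \<Rightarrow> 'y \<Rightarrow> real) \<Rightarrow> ('x \<Rightarrow> 'y) \<Rightarrow> (nat \<Rightarrow> 'x \<times> 'y) \<Rightarrow> real" where
  "empirical_risk N loss h s = (\<Sum>n<N. loss (h (fst (s n))) (snd (s n))) / real N"

text \<open>
  The event in question is not assumed to be measurable, so a probability of at least \<open>q\<close> is
  stated by means of a measurable event contained in it; for a measurable event this is just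
  \<open>measure M {w \<in> space M. P w} \<ge> q\<close>.
\<close>

definition with_prob_ge :: "'w measure \<Rightarrow> real \<Rightarrow> ('w \<Rightarrow> bool) \<Rightarrow> bool" where
  "with_prob_ge M q P \<longleftrightarrow> (\<exists>A\<in>sets M. (\<forall>w\<in>A. P w) \<and> q \<le> measure M A)"

section \<open>Constrained problems and their augmented duals\<close>

text \<open>
  A family \<open>l :: nat \<Rightarrow> 'a \<Rightarrow> real\<close> represents the objective \<open>l 0\<close> and the
  constraint functions \<open>l 1, \<dots>, l m\<close>.  The statistical and the empirical problem
  are both instances.  Optimal values are extended reals.
\<close>

definition feasible :: "'a set \<Rightarrow> nat \<Rightarrow> (nat \<Rightarrow> 'a \<Rightarrow> real) \<Rightarrow> 'a set" where
  "feasible \<Theta> m l = {\<theta>\<in>\<Theta>. \<forall>i\<in>{1..m}. l i \<theta> \<le> 0}"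

definition primal_value :: "'a set \<Rightarrow> nat \<Rightarrow> (nat \<Rightarrow> 'a \<Rightarrow> real) \<Rightarrow> ereal" where
  "primal_value \<Theta> m l = (INF \<theta>\<in>feasible \<Theta> m l. ereal (l 0 \<theta>))"

definition primal_solution :: "'a set \<Rightarrow> nat \<Rightarrow> (nat \<Rightarrow> 'a \<Rightarrow> real) \<Rightarrow> 'a \<Rightarrow> bool" where
  "primal_solution \<Theta> m l \<theta> \<longleftrightarrow>
     \<theta> \<in> feasible \<Theta> m l \<and> ereal (l 0 \<theta>) = primal_value \<Theta> m l"

definition Psi :: "real \<Rightarrow> real \<Rightarrow> real" where
  "Psi x y = ((max 0 (2 * x + y))\<^sup>2 - y\<^sup>2) / 4"

definition aug_lagrangian ::
  "nat \<Rightarrow> (nat \<Rightarrow> 'a \<Rightarrow> real) \<Rightarrow> 'a \<Rightarrow> (nat \<Rightarrow> real) \<Rightarrow> real \<Rightarrow> real" where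
  "aug_lagrangian m l \<theta> lam \<alpha> =
     l 0 \<theta> + \<alpha> * (\<Sum>i=1..m. Psi (l i \<theta>) (lam i / \<alpha>))"

text \<open>\<open>\<real>\<^sup>m\<close> is represented by the extensional functions on \<open>{1..m}\<close>.\<close>

definition multipliers :: "nat \<Rightarrow> ((nat \<Rightarrow> real) \<times> real) set" where
  "multipliers m = ({1..m} \<rightarrow>\<^sub>E UNIV) \<times> {0<..}"

definition dual_function ::
  "'a set \<Rightarrow> nat \<Rightarrow> (nat \<Rightarrow> 'a \<Rightarrow> real) \<Rightarrow> (nat \<Rightarrow> real) \<times> real \<Rightarrow> ereal" where
  "dual_function \<Theta> m l = (\<lambda>(lam, \<alpha>). INF \<theta>\<in>\<Theta>. ereal (aug_lagrangian m l \<theta> lam \<alpha>))"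

definition dual_value :: "'a set \<Rightarrow> nat \<Rightarrow> (nat \<Rightarrow> 'a \<Rightarrow> real) \<Rightarrow> ereal" where
  "dual_value \<Theta> m l = (SUP t\<in>multipliers m. dual_function \<Theta> m l t)"

definition dual_solution ::
  "'a set \<Rightarrow> nat \<Rightarrow> (nat \<Rightarrow> 'a \<Rightarrow> real) \<Rightarrow> (nat \<Rightarrow> real) \<times> real \<Rightarrow> bool" where
  "dual_solution \<Theta> m l t \<longleftrightarrow>
     t \<in> multipliers m \<and> dual_function \<Theta> m l t = dual_value \<Theta> m l"

definition norm1 :: "nat \<Rightarrow> (nat \<Rightarrow> real) \<Rightarrow> real" where
  "norm1 m lam = (\<Sum>i=1..m. \<bar>lam i\<bar>)"

section \<open>First- and second-order conditions\<close>

text \<open>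
  \<open>F\<close> is twice continuously differentiable on \<open>S\<close> with gradient \<open>G\<close> and Hessian \<open>H\<close>.
  Derivatives are taken within \<open>S\<close>: functions on a parameter set \<open>S\<close> need not make sense
  outside of it.  For \<open>S = UNIV\<close>, and at interior points, \<open>G\<close> and \<open>H\<close> are unique and are
  the usual gradient and Hessian; the restriction to \<open>S\<close> of a function that is twice continuously
  differentiable near \<open>S\<close> also satisfies this, with its gradient and Hessian.
\<close>

definition C2_on ::
  "(real^'p) set \<Rightarrow> (real^'p \<Rightarrow> real) \<Rightarrow> (real^'p \<Rightarrow> real^'p) \<Rightarrow> (real^'p \<Rightarrow> real^'p^'p) \<Rightarrow> bool"
  where
  "C2_on S F G H \<longleftrightarrow>
     (\<forall>x\<in>S. (F has_derivative (\<lambda>h. G x \<bullet> h)) (at x within S)) \<and>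
     (\<forall>x\<in>S. (G has_derivative (\<lambda>h. H x *v h)) (at x within S)) \<and>
     continuous_on S H"

definition active :: "nat \<Rightarrow> (nat \<Rightarrow> 'a \<Rightarrow> real) \<Rightarrow> 'a \<Rightarrow> nat set" where
  "active m l \<theta> = {i\<in>{1..m}. l i \<theta> = 0}"

text \<open>
  Linear independence of the gradients as a family: coinciding gradients of two distinct active
  constraints violate the condition.
\<close>

definition LICQ ::
  "nat \<Rightarrow> (nat \<Rightarrow> real^'p \<Rightarrow> real) \<Rightarrow> (nat \<Rightarrow> real^'p \<Rightarrow> real^'p) \<Rightarrow> real^'p \<Rightarrow> bool" where
  "LICQ m l G \<theta> \<longleftrightarrow>
     inj_on (\<lambda>i. G i \<theta>) (active m l \<theta>) \<and> independent ((\<lambda>i. G i \<theta>) ` active m l \<theta>)"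

definition KKT ::
  "nat \<Rightarrow> (nat \<Rightarrow> real^'p \<Rightarrow> real) \<Rightarrow> (nat \<Rightarrow> real^'p \<Rightarrow> real^'p) \<Rightarrow>
   real^'p \<Rightarrow> (nat \<Rightarrow> real) \<Rightarrow> bool" where
  "KKT m l G \<theta> lam \<longleftrightarrow>
     G 0 \<theta> + (\<Sum>i=1..m. lam i *\<^sub>R G i \<theta>) = 0 \<and>
     (\<forall>i\<in>{1..m}. l i \<theta> \<le> 0 \<and> 0 \<le> lam i \<and> lam i * l i \<theta> = 0)"

definition critical_cone ::
  "nat \<Rightarrow> (nat \<Rightarrow> real^'p \<Rightarrow> real) \<Rightarrow> (nat \<Rightarrow> real^'p \<Rightarrow> real^'p) \<Rightarrow>
   real^'p \<Rightarrow> (nat \<Rightarrow> real) \<Rightarrow> (real^'p) set" where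
  "critical_cone m l G \<theta> lam =
     {z. (\<forall>i\<in>active m l \<theta>. lam i > 0 \<longrightarrow> G i \<theta> \<bullet> z = 0) \<and>
         (\<forall>i\<in>active m l \<theta>. lam i = 0 \<longrightarrow> G i \<theta> \<bullet> z \<le> 0)}"

end

theory Submission
  imports Defs
begin

text \<open>
  With zero multipliers and \<open>\<alpha> \<rightarrow> \<infinity>\<close> the augmented Lagrangian is a quadratic penalty function, so
  compactness of the level set yields \<open>P\<^sup>\<star> \<le> sup (D)\<close>.  Attainment of the two duals then gives
  \<open>P\<^sup>\<star> \<le> L(\<theta>, \<lambda>\<^sup>\<star>, \<alpha>\<^sup>\<star>)\<close> at the empirical solution \<open>\<theta>\<close>, and
  \<open>inf (P\<^sub>e) \<le> L\<^sub>e(\<theta>\<^sup>\<star>, \<lambda>, \<alpha>)\<close> for the empirical problem at a solution \<open>\<theta>\<^sup>\<star>\<close> of the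
  statistical one.  On the event of uniform closeness (of probability at least
  \<open>1 - (m + 1) \<delta>\<close>) each of the two points violates the constraints of the other problem by at
  most \<open>b\<close>, the maximum of the \<open>\<zeta>\<^sub>i\<close>, and \<open>\<alpha> \<Psi>(x, \<lambda>\<^sub>i / \<alpha>) \<le> \<bar>\<lambda>\<^sub>i\<bar> b + \<alpha> b\<^sup>2\<close> whenever \<open>x \<le> b\<close>.
\<close>

section \<open>Upper bounds for the augmented Lagrangian\<close>

text \<open>\<open>Psi\<close> is nondecreasing in its first argument. Where the maximum is zero its
  value is nonpositive; elsewhere replacing \<open>x\<close> by \<open>b\<close> raises the value to
  exactly \<open>y * b + b\<^sup>2\<close>.\<close>

lemma Psi_le:
  assumes "x \<le> b" "0 \<le> b"
  shows "Psi x y \<le> \<bar>y\<bar> * b + b\<^sup>2"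
proof (cases "2 * x + y \<le> 0")
  case True
  have "0 \<le> \<bar>y\<bar> * b" using assms by simp
  with True show ?thesis
    by (simp add: Psi_def max_def) (smt (verit) zero_le_power2)
next
  case False
  have "(2 * x + y)\<^sup>2 \<le> (2 * b + y)\<^sup>2"
    using False assms by (intro power_mono) auto
  then have "Psi x y \<le> ((2 * b + y)\<^sup>2 - y\<^sup>2) / 4"
    using False by (simp add: Psi_def max_def)
  also have "\<dots> = y * b + b\<^sup>2"
    by (simp add: power2_eq_square algebra_simps)
  also have "\<dots> \<le> \<bar>y\<bar> * b + b\<^sup>2"
    using assms by (simp add: mult_right_mono)
  finally show ?thesis .
qed

text \<open>In the sum of the termwise bounds, \<alpha> cancels against
  \<open>lam i / \<alpha>\<close> but stays on \<open>b\<^sup>2\<close>. The case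
  \<open>b = 0\<close> is weak duality at a feasible point.\<close>

lemma aug_lagrangian_le:
  assumes "0 < \<alpha>" "0 \<le> b" "\<And>i. i \<in> {1..m} \<Longrightarrow> l i \<theta> \<le> b"
  shows "aug_lagrangian m l \<theta> lam \<alpha> \<le> l 0 \<theta> + norm1 m lam * b + \<alpha> * real m * b\<^sup>2"
proof -
  have "\<alpha> * (\<Sum>i=1..m. Psi (l i \<theta>) (lam i / \<alpha>))
      \<le> \<alpha> * (\<Sum>i=1..m. \<bar>lam i / \<alpha>\<bar> * b + b\<^sup>2)"
    using assms by (intro mult_left_mono sum_mono Psi_le) auto
  also have "\<dots> = (\<Sum>i=1..m. \<bar>lam i\<bar> * b + \<alpha> * b\<^sup>2)"
    using \<open>0 < \<alpha>\<close> by (auto simp: sum_distrib_left field_simps intro!: sum.cong)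
  also have "\<dots> = norm1 m lam * b + \<alpha> * real m * b\<^sup>2"
    by (simp add: norm1_def sum.distrib sum_distrib_right)
  finally show ?thesis by (simp add: aug_lagrangian_def)
qed

lemma dual_solution_pos: "dual_solution \<Theta> m l (lam, \<alpha>) \<Longrightarrow> 0 < \<alpha>"
  by (auto simp: dual_solution_def multipliers_def)

text \<open>By attainment the dual value is the infimum for this single pair, so one pair serves all
  points of \<Theta>.\<close>

lemma dual_value_le_aug_lagrangian:
  assumes "dual_solution \<Theta> m l (lam, \<alpha>)" "\<theta> \<in> \<Theta>"
  shows "dual_value \<Theta> m l \<le> ereal (aug_lagrangian m l \<theta> lam \<alpha>)"
proof -
  have "dual_value \<Theta> m l = dual_function \<Theta> m l (lam, \<alpha>)"
    using assms by (simp add: dual_solution_def)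
  also have "\<dots> \<le> ereal (aug_lagrangian m l \<theta> lam \<alpha>)"
    using assms by (auto simp: dual_function_def intro: INF_lower)
  finally show ?thesis .
qed

section \<open>Strong duality by penalization and compactness\<close>

text \<open>If a real \<open>c\<close> separated the two values, points with penalized objective
  below \<open>c\<close> would accumulate, as the weight grows, at a feasible point with objective
  at most \<open>c\<close>.\<close>

lemma primal_value_le_dual_value:
  fixes l :: "nat \<Rightarrow> 'a::metric_space \<Rightarrow> real"
  assumes bdd: "bdd_below (l 0 ` \<Theta>)"
    and cont: "\<And>i. i \<le> m \<Longrightarrow> continuous_on \<Theta> (l i)"
    and u: "0 < u" and pbar: "primal_value \<Theta> m l < ereal pbar"
    and comp: "compact {\<theta>\<in>\<Theta>. l 0 \<theta> \<le> pbar \<and> (\<forall>i\<in>{1..m}. l i \<theta> \<le> u)}"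
  shows "primal_value \<Theta> m l \<le> dual_value \<Theta> m l"
proof (rule ccontr)
  define K where "K = {\<theta>\<in>\<Theta>. l 0 \<theta> \<le> pbar \<and> (\<forall>i\<in>{1..m}. l i \<theta> \<le> u)}"
  assume "\<not> ?thesis"
  then obtain c where c: "dual_value \<Theta> m l < ereal c" "ereal c < primal_value \<Theta> m l"
    using ereal_dense2 by (metis not_le)
  \<comment> \<open>This puts points of objective at most \<open>c\<close> within the level
    \<open>pbar\<close> of the compact set.\<close>
  with pbar have "c < pbar" by (metis ereal_less(1) less_ereal.simps(1) less_trans)
  obtain B where B: "\<And>\<theta>. \<theta> \<in> \<Theta> \<Longrightarrow> B \<le> l 0 \<theta>"
    using bdd by (auto simp: bdd_below_def)
  let ?pen = "\<lambda>\<theta>. \<Sum>i=1..m. (max 0 (l i \<theta>))\<^sup>2"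
  have "\<exists>\<theta>\<in>\<Theta>. l 0 \<theta> + a * ?pen \<theta> < c" if "0 < a" for a
  proof -
    \<comment> \<open>Since \<open>Psi x 0 = (max 0 x)\<^sup>2\<close>, zero multipliers turn the
      parameter \<open>a\<close> into a penalty weight.\<close>
    let ?t = "(\<lambda>i\<in>{1..m}. 0, a) :: (nat \<Rightarrow> real) \<times> real"
    have "?t \<in> multipliers m" using that by (auto simp: multipliers_def)
    then have "dual_function \<Theta> m l ?t \<le> dual_value \<Theta> m l"
      unfolding dual_value_def by (rule SUP_upper)
    then have "dual_function \<Theta> m l ?t < ereal c" using c(1) by simp
    then obtain \<theta> where "\<theta> \<in> \<Theta>" "aug_lagrangian m l \<theta> (\<lambda>i\<in>{1..m}. 0) a < c"
      by (auto simp: dual_function_def INF_less_iff)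
    moreover have "(\<Sum>i=1..m. Psi (l i \<theta>) ((\<lambda>i\<in>{1..m}. 0) i / a)) = ?pen \<theta>"
      by (intro sum.cong) (auto simp: Psi_def max_def power2_eq_square)
    ultimately show ?thesis by (auto simp: aug_lagrangian_def)
  qed
  then have "\<exists>\<theta>\<in>\<Theta>. l 0 \<theta> + real (Suc k) * ?pen \<theta> < c" for k
    by (metis of_nat_0_less_iff zero_less_Suc)
  then obtain s where s: "\<And>k. s k \<in> \<Theta>" "\<And>k. l 0 (s k) + real (Suc k) * ?pen (s k) < c"
    by metis
  have s0: "l 0 (s k) \<le> c" for k
  proof -
    have "0 \<le> real (Suc k) * ?pen (s k)" by (intro mult_nonneg_nonneg sum_nonneg) auto
    with s(2)[of k] show ?thesis by linarith
  qed
  \<comment> \<open>The lower bound \<open>B\<close> on the objective leaves at most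
    \<open>c - B\<close> for the weighted penalty, which gives a rate for each violation.\<close>
  have si: "(max 0 (l i (s k)))\<^sup>2 \<le> (c - B) / real (Suc k)" if "i \<in> {1..m}" for i k
  proof -
    have "(max 0 (l i (s k)))\<^sup>2 \<le> ?pen (s k)"
      using that by (intro member_le_sum) auto
    also have "\<dots> \<le> (c - B) / real (Suc k)"
      using s(2)[of k] B[OF s(1)[of k]] by (simp add: pos_le_divide_eq mult.commute)
    finally show ?thesis .
  qed
  have lim: "(\<lambda>k. (c - B) / real (Suc k)) \<longlonglongrightarrow> 0"
    using tendsto_mult[OF tendsto_const[of "c - B"] LIMSEQ_inverse_real_of_nat]
    by (simp add: divide_inverse)
  \<comment> \<open>Violations eventually drop below \<open>u > 0\<close>; discarding the first
    \<open>k0\<close> terms puts the whole sequence into \<open>K\<close>.\<close>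
  then have "eventually (\<lambda>k. (c - B) / real (Suc k) < u\<^sup>2) sequentially"
    using u by (intro order_tendstoD) auto
  then obtain k0 where k0: "\<And>k. k0 \<le> k \<Longrightarrow> (c - B) / real (Suc k) < u\<^sup>2"
    by (auto simp: eventually_sequentially)
  have sK: "s (k + k0) \<in> K" for k
  proof -
    have "l i (s (k + k0)) \<le> u" if "i \<in> {1..m}" for i
    proof -
      have "(max 0 (l i (s (k + k0))))\<^sup>2 \<le> u\<^sup>2"
        using si[OF that, of "k + k0"] k0[of "k + k0"] by simp
      then have "max 0 (l i (s (k + k0))) \<le> u"
        using less_imp_le[OF u] by (rule power2_le_imp_le)
      then show ?thesis by simp
    qed
    then show ?thesis using s(1) s0[of "k + k0"] \<open>c < pbar\<close> by (auto simp: K_def)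
  qed
  obtain t r where tr: "t \<in> K" "strict_mono r" "(\<lambda>k. s (r k + k0)) \<longlonglongrightarrow> t"
    using seq_compactE[OF comp[folded K_def, unfolded compact_eq_seq_compact_metric],
        of "\<lambda>k. s (k + k0)"] sK unfolding o_def by blast
  have t: "t \<in> \<Theta>" using tr(1) by (simp add: K_def)
  have lt: "(\<lambda>k. l i (s (r k + k0))) \<longlonglongrightarrow> l i t" if "i \<le> m" for i
    using continuous_on_tendsto_compose[OF cont[OF that] tr(3) t] s(1) by simp
  have "strict_mono (\<lambda>k. r k + k0)" using tr(2) by (simp add: strict_mono_def)
  from LIMSEQ_subseq_LIMSEQ[OF lim this]
  have lim': "(\<lambda>k. (c - B) / real (Suc (r k + k0))) \<longlonglongrightarrow> 0" by (simp add: o_def)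
  \<comment> \<open>The squared violations converge to the one at \<open>t\<close> and are dominated
    by a null sequence.\<close>
  have "l i t \<le> 0" if i: "i \<in> {1..m}" for i
  proof -
    have "(\<lambda>k. (max 0 (l i (s (r k + k0))))\<^sup>2) \<longlonglongrightarrow> (max 0 (l i t))\<^sup>2"
      using i by (intro tendsto_intros lt) auto
    then have "(max 0 (l i t))\<^sup>2 \<le> 0"
      using lim' by (rule LIMSEQ_le) (use si[OF i] in blast)
    then show ?thesis by simp
  qed
  then have "t \<in> feasible \<Theta> m l" using t by (auto simp: feasible_def)
  then have "primal_value \<Theta> m l \<le> ereal (l 0 t)"
    unfolding primal_value_def by (rule INF_lower)
  moreover have "l 0 t \<le> c"
    using lt[of 0] s0 by (intro LIMSEQ_le_const2) auto
  ultimately show False using c(2) by (metis ereal_less_eq(3) not_le order_trans)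
qed

section \<open>Deterministic consequences of duality\<close>

text \<open>The primal value lies below the augmented Lagrangian everywhere on \<Theta>, while
  feasibility bounds the augmented Lagrangian at \<theta> by that same value.\<close>

lemma primal_solution_is_arg_min_aug_lagrangian:
  assumes "primal_value \<Theta> m l \<le> dual_value \<Theta> m l"
    and dual: "dual_solution \<Theta> m l (lam, \<alpha>)" and primal: "primal_solution \<Theta> m l \<theta>"
  shows "is_arg_min (\<lambda>\<theta>. aug_lagrangian m l \<theta> lam \<alpha>) (\<lambda>\<theta>. \<theta> \<in> \<Theta>) \<theta>"
proof -
  have \<theta>: "\<theta> \<in> \<Theta>" "\<And>i. i \<in> {1..m} \<Longrightarrow> l i \<theta> \<le> 0"
    using primal by (auto simp: primal_solution_def feasible_def)
  have "aug_lagrangian m l \<theta> lam \<alpha> \<le> aug_lagrangian m l \<theta>' lam \<alpha>" if "\<theta>' \<in> \<Theta>" for \<theta>'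
  proof -
    have "ereal (l 0 \<theta>) \<le> ereal (aug_lagrangian m l \<theta>' lam \<alpha>)"
      using dual_value_le_aug_lagrangian[OF dual that] assms(1) primal
      by (simp add: primal_solution_def)
    moreover have "aug_lagrangian m l \<theta> lam \<alpha> \<le> l 0 \<theta>"
      using aug_lagrangian_le[OF dual_solution_pos[OF dual], of 0 m l \<theta> lam] \<theta>(2) by simp
    ultimately show ?thesis by simp
  qed
  then show ?thesis using \<theta>(1) by (auto simp: is_arg_min_def not_less)
qed

text \<open>The dual pair prices a violation of size \<open>b\<close>: linearly through
  \<open>norm1 m lam\<close>, quadratically through \<alpha>.\<close>

lemma primal_value_le_perturbed:
  assumes "primal_value \<Theta> m l \<le> dual_value \<Theta> m l"
    and dual: "dual_solution \<Theta> m l (lam, \<alpha>)"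
    and "\<theta> \<in> \<Theta>" "0 \<le> b" "\<And>i. i \<in> {1..m} \<Longrightarrow> l i \<theta> \<le> b"
  shows "primal_value \<Theta> m l \<le> ereal (l 0 \<theta> + norm1 m lam * b + \<alpha> * real m * b\<^sup>2)"
proof -
  have "primal_value \<Theta> m l \<le> ereal (aug_lagrangian m l \<theta> lam \<alpha>)"
    using dual_value_le_aug_lagrangian[OF dual \<open>\<theta> \<in> \<Theta>\<close>] assms(1) by simp
  also have "\<dots> \<le> ereal (l 0 \<theta> + norm1 m lam * b + \<alpha> * real m * b\<^sup>2)"
    using aug_lagrangian_le[where l = l and \<theta> = \<theta> and lam = lam, OF dual_solution_pos[OF dual] assms(4,5)]
    by simp
  finally show ?thesis .
qed

text \<open>Each solution violates the constraints of the other problem by at most \<open>b\<close>,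
  so the perturbation bound applies once in each direction.\<close>

lemma primal_gap_le:
  assumes sd: "primal_value \<Theta> m l \<le> dual_value \<Theta> m l"
    and sd': "primal_value \<Theta> m l' \<le> dual_value \<Theta> m l'"
    and dual: "dual_solution \<Theta> m l (lam, \<alpha>)" and dual': "dual_solution \<Theta> m l' (lam', \<alpha>')"
    and primal: "primal_solution \<Theta> m l \<theta>" and primal': "primal_solution \<Theta> m l' \<theta>'"
    and close: "\<And>i x. i \<le> m \<Longrightarrow> x \<in> \<Theta> \<Longrightarrow> \<bar>l i x - l' i x\<bar> \<le> b"
  shows "\<bar>primal_value \<Theta> m l - ereal (l 0 \<theta>')\<bar>
    \<le> ereal ((2 + max (norm1 m lam) (norm1 m lam')) * b + max \<alpha> \<alpha>' * real m * b\<^sup>2)"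
proof -
  have \<theta>: "\<theta> \<in> \<Theta>" "\<And>i. i \<in> {1..m} \<Longrightarrow> l i \<theta> \<le> 0"
    and pv: "primal_value \<Theta> m l = ereal (l 0 \<theta>)"
    and \<theta>': "\<theta>' \<in> \<Theta>" "\<And>i. i \<in> {1..m} \<Longrightarrow> l' i \<theta>' \<le> 0"
    and pv': "primal_value \<Theta> m l' = ereal (l' 0 \<theta>')"
    using primal primal' by (auto simp: primal_solution_def feasible_def)
  have b: "0 \<le> b" using close[of 0, OF _ \<theta>(1)] by simp
  have "l i \<theta>' \<le> b" if "i \<in> {1..m}" for i
    using close[of i \<theta>'] \<theta>'(1) \<theta>'(2)[OF that] that by simp
  from primal_value_le_perturbed[OF sd dual \<theta>'(1) b this]
  have 1: "l 0 \<theta> \<le> l 0 \<theta>' + norm1 m lam * b + \<alpha> * real m * b\<^sup>2" by (simp add: pv)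
  have "l' i \<theta> \<le> b" if "i \<in> {1..m}" for i
    using close[of i \<theta>] \<theta>(1) \<theta>(2)[OF that] that by simp
  from primal_value_le_perturbed[OF sd' dual' \<theta>(1) b this]
  have 2: "l' 0 \<theta>' \<le> l' 0 \<theta> + norm1 m lam' * b + \<alpha>' * real m * b\<^sup>2" by (simp add: pv')
  \<comment> \<open>These dominate the terms of both directions; once they are named, the remaining
    estimate is linear.\<close>
  define \<Delta>\<^sub>1 \<Delta>\<^sub>2 where "\<Delta>\<^sub>1 = max (norm1 m lam) (norm1 m lam') * b"
    and "\<Delta>\<^sub>2 = max \<alpha> \<alpha>' * real m * b\<^sup>2"
  have "norm1 m lam * b \<le> \<Delta>\<^sub>1" "norm1 m lam' * b \<le> \<Delta>\<^sub>1"
    "\<alpha> * real m * b\<^sup>2 \<le> \<Delta>\<^sub>2" "\<alpha>' * real m * b\<^sup>2 \<le> \<Delta>\<^sub>2"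
    unfolding \<Delta>\<^sub>1_def \<Delta>\<^sub>2_def using b by (auto intro!: mult_right_mono)
  \<comment> \<open>Only the bound on \<open>l 0 \<theta>' - l 0 \<theta>\<close> spends
    \<open>2 * b\<close>: one \<open>b\<close> for passing from \<open>l\<close> to
    \<open>l'\<close> at \<open>\<theta>'\<close>, one for returning at \<theta>.\<close>
  then have "\<bar>l 0 \<theta> - l 0 \<theta>'\<bar> \<le> 2 * b + \<Delta>\<^sub>1 + \<Delta>\<^sub>2"
    using 1 2 close[of 0, OF _ \<theta>(1)] close[of 0, OF _ \<theta>'(1)] b by (simp add: abs_le_iff)
  then show ?thesis by (simp add: pv \<Delta>\<^sub>1_def \<Delta>\<^sub>2_def distrib_right)
qed

section \<open>Samples and probability events\<close>

text \<open>Points of \<open>PiM\<close> are extensional, so a sample enters the product space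
  restricted to its indices; the empirical risk reads no others.\<close>

lemma empirical_risk_restrict:
  "empirical_risk N loss h (restrict s {..<N}) = empirical_risk N loss h s"
  by (simp add: empirical_risk_def)

lemma with_prob_ge_mono:
  "with_prob_ge M p P \<Longrightarrow> q \<le> p \<Longrightarrow> (\<And>w. w \<in> space M \<Longrightarrow> P w \<Longrightarrow> Q w) \<Longrightarrow> with_prob_ge M q Q"
  unfolding with_prob_ge_def by (meson order_trans sets.sets_into_space subsetD)

text \<open>The joint law of an i.i.d. sample is the product measure, so a witnessing event there
  pulls back to one of equal probability in \<open>M\<close>.\<close>

lemma (in prob_space) with_prob_ge_iid_sample:
  assumes "I \<noteq> {}" "indep_vars (\<lambda>_. D) X I" "\<And>n. n \<in> I \<Longrightarrow> distr M D (X n) = D"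
    and "with_prob_ge (PiM I (\<lambda>_. D)) q P"
  shows "with_prob_ge M q (\<lambda>w. P (\<lambda>n\<in>I. X n w))"
proof -
  let ?X = "\<lambda>w. \<lambda>n\<in>I. X n w" and ?P = "PiM I (\<lambda>_. D)"
  obtain A where A: "A \<in> sets ?P" "\<And>s. s \<in> A \<Longrightarrow> P s" "q \<le> measure ?P A"
    using assms(4) by (auto simp: with_prob_ge_def)
  have rv: "X n \<in> measurable M D" if "n \<in> I" for n
    using assms(2) that by (auto simp: indep_vars_def2)
  then have meas: "?X \<in> measurable M ?P" by (intro measurable_restrict) auto
  have "distr M ?P ?X = PiM I (\<lambda>n. distr M D (X n))"
    using assms(1,2) rv by (subst indep_vars_iff_distr_eq_PiM'[symmetric]) auto
  also have "\<dots> = ?P" using assms(3) by (intro PiM_cong) auto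
  finally have "q \<le> measure (distr M ?P ?X) A" using A(3) by simp
  then have "q \<le> measure M (?X -` A \<inter> space M)"
    by (simp add: measure_distr[OF meas A(1)])
  moreover have "?X -` A \<inter> space M \<in> sets M" using meas A(1) by (rule measurable_sets)
  moreover have "\<forall>w\<in>?X -` A \<inter> space M. P (?X w)" using A(2) by blast
  ultimately show ?thesis unfolding with_prob_ge_def by blast
qed

text \<open>Union bound over the complements of the witnessing events; the events may depend on each
  other.\<close>

lemma (in prob_space) with_prob_ge_ball:
  assumes "finite I" "\<And>i. i \<in> I \<Longrightarrow> with_prob_ge M (1 - d) (P i)"
  shows "with_prob_ge M (1 - real (card I) * d) (\<lambda>w. \<forall>i\<in>I. P i w)"
proof -
  have "\<forall>i\<in>I. \<exists>A. A \<in> sets M \<and> (\<forall>w\<in>A. P i w) \<and> 1 - d \<le> prob A"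
    using assms(2) unfolding with_prob_ge_def by blast
  then obtain A where A: "\<And>i. i \<in> I \<Longrightarrow> A i \<in> sets M"
    "\<And>i w. i \<in> I \<Longrightarrow> w \<in> A i \<Longrightarrow> P i w" "\<And>i. i \<in> I \<Longrightarrow> 1 - d \<le> prob (A i)"
    by metis
  let ?C = "\<Union>i\<in>I. space M - A i"
  have C: "?C \<in> sets M" using A(1) assms(1) by (intro sets.finite_UN) auto
  have "prob ?C \<le> (\<Sum>i\<in>I. prob (space M - A i))"
    using A(1) assms(1) by (intro finite_measure_subadditive_finite) auto
  also have "\<dots> \<le> (\<Sum>i\<in>I. d)"
    using A(1,3) by (intro sum_mono) (fastforce simp: prob_compl)
  finally have "1 - real (card I) * d \<le> prob (space M - ?C)"
    using C by (simp add: prob_compl)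
  moreover have "space M - ?C \<in> sets M" using C by auto
  moreover have "\<forall>w\<in>space M - ?C. \<forall>i\<in>I. P i w" using A(2) by blast
  ultimately show ?thesis unfolding with_prob_ge_def by blast
qed

text \<open>A measurable null set covering the failures of \<open>Q\<close> is cut out of the
  witness without loss of probability.\<close>

lemma (in prob_space) with_prob_ge_AE:
  assumes "with_prob_ge M q P" "AE w in M. Q w"
  shows "with_prob_ge M q (\<lambda>w. P w \<and> Q w)"
proof -
  obtain A where A: "A \<in> sets M" "\<And>w. w \<in> A \<Longrightarrow> P w" "q \<le> prob A"
    using assms(1) by (auto simp: with_prob_ge_def)
  obtain E where E: "{w\<in>space M. \<not> Q w} \<subseteq> E" "emeasure M E = 0" "E \<in> sets M"
    using AE_E[OF assms(2)] by blast
  have "prob (A - E) = prob A"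
    using A(1) E by (intro measure_Diff_null_set) auto
  moreover have "Q w" if "w \<in> A - E" for w
    using that E(1) sets.sets_into_space[OF A(1)] by auto
  ultimately show ?thesis using A E unfolding with_prob_ge_def by (auto intro!: bexI[of _ "A - E"])
qed

theorem theorem2p3:
  fixes \<Theta> :: "(real^'p) set"
    and f :: "real^'p \<Rightarrow> 'x \<Rightarrow> 'y::topological_space"
    and m :: nat
    and D :: "nat \<Rightarrow> ('x \<times> 'y) measure"
    and loss :: "nat \<Rightarrow> 'y \<Rightarrow> 'y \<Rightarrow> real"
    and l :: "nat \<Rightarrow> real^'p \<Rightarrow> real"
    and M :: "'w measure"
    and N :: "nat \<Rightarrow> nat"
    and Z :: "nat \<Rightarrow> nat \<Rightarrow> 'w \<Rightarrow> 'x \<times> 'y"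
    and lhat :: "'w \<Rightarrow> nat \<Rightarrow> real^'p \<Rightarrow> real"
    and \<zeta> :: "nat \<Rightarrow> nat \<Rightarrow> real \<Rightarrow> real"
    and \<delta> :: real
    and G :: "nat \<Rightarrow> real^'p \<Rightarrow> real^'p"
    and H :: "nat \<Rightarrow> real^'p \<Rightarrow> real^'p^'p"
    and G\<^sub>L :: "real^'p \<Rightarrow> real^'p"
    and H\<^sub>L :: "real^'p \<Rightarrow> real^'p^'p"
    and \<theta>star \<theta>bar :: "real^'p"
    and lambar lamstar :: "nat \<Rightarrow> real"
    and \<alpha>star :: real
  \<comment> \<open>distributions, losses and population risks\<close>
  assumes D: "\<And>i. i \<le> m \<Longrightarrow> prob_space (D i)"
    and loss_measurable: "\<And>i \<theta>. i \<le> m \<Longrightarrow> \<theta> \<in> \<Theta> \<Longrightarrow>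
          (\<lambda>z. loss i (f \<theta> (fst z)) (snd z)) \<in> borel_measurable (D i)"
    and l: "l = (\<lambda>i \<theta>. risk (D i) (loss i) (f \<theta>))"
  \<comment> \<open>samples and empirical risks\<close>
    and M: "prob_space M"
    and N: "\<And>i. i \<le> m \<Longrightarrow> N i \<ge> 1"
    and sample_indep: "\<And>i. i \<le> m \<Longrightarrow> prob_space.indep_vars M (\<lambda>_. D i) (Z i) {..<N i}"
    and sample_distr: "\<And>i n. i \<le> m \<Longrightarrow> n < N i \<Longrightarrow> distr M (D i) (Z i n) = D i"
    and lhat: "lhat = (\<lambda>w i \<theta>. empirical_risk (N i) (loss i) (f \<theta>) (\<lambda>n. Z i n w))"
    and \<delta>: "0 < \<delta>" "\<delta> < 1"
    and bounded_objective: "bdd_below (l 0 ` \<Theta>)"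
    and closed_domain: "closed \<Theta>"
    and f_continuous: "continuous_on \<Theta> f"
    and loss_continuous: "\<And>i y. i \<le> m \<Longrightarrow> continuous_on UNIV (\<lambda>u. loss i u y)"
    and loss_bounded: "\<And>i. i \<le> m \<Longrightarrow> \<exists>B. \<forall>y u. \<bar>loss i u y\<bar> \<le> B"
    and compact_level: "\<exists>u>0. \<exists>pbar::real. ereal pbar > primal_value \<Theta> m l \<and>
          compact {\<theta>\<in>\<Theta>. l 0 \<theta> \<le> pbar \<and> (\<forall>i\<in>{1..m}. l i \<theta> \<le> u)}"
    and \<theta>star: "primal_solution \<Theta> m l \<theta>star"
    and licq: "LICQ m l G \<theta>star"
    and smooth: "\<And>i. i \<le> m \<Longrightarrow> C2_on \<Theta> (l i) (G i) (H i)"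
    and \<theta>bar: "\<theta>bar \<in> \<Theta>"
    and kkt: "KKT m l G \<theta>bar lambar"
    and lagrangian_hessian:
      "C2_on \<Theta> (\<lambda>\<theta>. l 0 \<theta> + (\<Sum>i=1..m. lambar i * l i \<theta>)) G\<^sub>L H\<^sub>L"
    and second_order:
      "\<And>z. z \<in> critical_cone m l G \<theta>bar lambar \<Longrightarrow> z \<noteq> 0 \<Longrightarrow> z \<bullet> (H\<^sub>L \<theta>bar *v z) > 0"
    and \<zeta>_nonneg: "\<And>i k d. i \<le> m \<Longrightarrow> k \<ge> 1 \<Longrightarrow> 0 < d \<Longrightarrow> d < 1 \<Longrightarrow> 0 \<le> \<zeta> i k d"
    and \<zeta>_decreasing: "\<And>i k k' d. i \<le> m \<Longrightarrow> 1 \<le> k \<Longrightarrow> k \<le> k' \<Longrightarrow> 0 < d \<Longrightarrow> d < 1 \<Longrightarrow>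
          \<zeta> i k' d \<le> \<zeta> i k d"
    and uniform_convergence: "\<And>i k d. i \<le> m \<Longrightarrow> k \<ge> 1 \<Longrightarrow> 0 < d \<Longrightarrow> d < 1 \<Longrightarrow>
          with_prob_ge (PiM {..<k} (\<lambda>_. D i)) (1 - d)
            (\<lambda>s. \<forall>\<theta>\<in>\<Theta>. \<bar>l i \<theta> - empirical_risk k (loss i) (f \<theta>) s\<bar> \<le> \<zeta> i k d)"
    and empirical_duality: "AE w in M. primal_value \<Theta> m (lhat w) = dual_value \<Theta> m (lhat w) \<and>
          (\<exists>t. dual_solution \<Theta> m (lhat w) t)"
  \<comment> \<open>solution of the augmented dual\<close>
    and dual: "dual_solution \<Theta> m l (lamstar, \<alpha>star)"
  shows "(AE w in M. \<forall>lamhat \<alpha>hat \<theta>hat.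
           dual_solution \<Theta> m (lhat w) (lamhat, \<alpha>hat) \<longrightarrow> primal_solution \<Theta> m (lhat w) \<theta>hat \<longrightarrow>
           is_arg_min (\<lambda>\<theta>. aug_lagrangian m (lhat w) \<theta> lamhat \<alpha>hat) (\<lambda>\<theta>. \<theta> \<in> \<Theta>) \<theta>hat) \<and>
         with_prob_ge M (1 - (2 * real m + 1) * \<delta>) (\<lambda>w. \<forall>lamhat \<alpha>hat \<theta>hat.
           dual_solution \<Theta> m (lhat w) (lamhat, \<alpha>hat) \<longrightarrow> primal_solution \<Theta> m (lhat w) \<theta>hat \<longrightarrow>
           (let \<zeta>bar = Max ((\<lambda>i. \<zeta> i (N i) \<delta>) ` {0..m});
                \<Delta>lam = max (norm1 m lamstar) (norm1 m lamhat);
                \<Delta>\<alpha> = max \<alpha>star \<alpha>hat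
            in \<bar>primal_value \<Theta> m l - ereal (l 0 \<theta>hat)\<bar>
                 \<le> ereal ((2 + \<Delta>lam) * \<zeta>bar + \<Delta>\<alpha> * real m * \<zeta>bar\<^sup>2) \<and>
               (\<forall>i\<in>{1..m}. l i \<theta>hat \<le> \<zeta> i (N i) \<delta>)))"
proof -
  interpret prob_space M by (rule M)
  have sd: "primal_value \<Theta> m l \<le> dual_value \<Theta> m l"
  proof -
    \<comment> \<open>Continuity of the risks comes from the first-order part of
      \<open>C2_on\<close>.\<close>
    have "continuous_on \<Theta> (l i)" if "i \<le> m" for i
      using smooth[OF that] has_derivative_continuous_on[of \<Theta> "l i" "\<lambda>x h. G i x \<bullet> h"]
      by (simp add: C2_on_def)
    with compact_level bounded_objective show ?thesis
      by (blast intro: primal_value_le_dual_value)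
  qed
  define \<zeta>bar where "\<zeta>bar = Max ((\<lambda>i. \<zeta> i (N i) \<delta>) ` {0..m})"
  define close where "close = (\<lambda>w i. \<forall>\<theta>\<in>\<Theta>. \<bar>l i \<theta> - lhat w i \<theta>\<bar> \<le> \<zeta> i (N i) \<delta>)"
  define duality where "duality = (\<lambda>w. primal_value \<Theta> m (lhat w) \<le> dual_value \<Theta> m (lhat w))"
  have dual_ae: "AE w in M. duality w"
    using empirical_duality unfolding duality_def by eventually_elim simp
  have "with_prob_ge M (1 - \<delta>) (\<lambda>w. close w i)" if "i \<le> m" for i
    using with_prob_ge_iid_sample[OF _ sample_indep[OF that] sample_distr[OF that]
        uniform_convergence[OF that N[OF that] \<delta>]] N[OF that]
    by (simp add: close_def lhat empirical_risk_restrict lessThan_empty_iff)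
  \<comment> \<open>The \<open>m + 1\<close> events belong to the objective and the \<open>m\<close>
    constraints.\<close>
  then have "with_prob_ge M (1 - real (card {0..m}) * \<delta>) (\<lambda>w. \<forall>i\<in>{0..m}. close w i)"
    by (intro with_prob_ge_ball) auto
  then have event: "with_prob_ge M (1 - real (card {0..m}) * \<delta>)
      (\<lambda>w. (\<forall>i\<in>{0..m}. close w i) \<and> duality w)"
    using dual_ae by (rule with_prob_ge_AE)
  \<comment> \<open>These bounds are deterministic: they hold at each good \<open>w\<close> for
    every choice of empirical solutions, so no measurable selection of solutions enters.\<close>
  have gap: "\<bar>primal_value \<Theta> m l - ereal (l 0 \<theta>hat)\<bar>
      \<le> ereal ((2 + max (norm1 m lamstar) (norm1 m lamhat)) * \<zeta>bar
        + max \<alpha>star \<alpha>hat * real m * \<zeta>bar\<^sup>2)"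
    and infeas: "\<And>i. i \<in> {1..m} \<Longrightarrow> l i \<theta>hat \<le> \<zeta> i (N i) \<delta>"
    if w: "\<forall>i\<in>{0..m}. close w i" "duality w" and dw: "dual_solution \<Theta> m (lhat w) (lamhat, \<alpha>hat)"
      and pw: "primal_solution \<Theta> m (lhat w) \<theta>hat" for w lamhat \<alpha>hat \<theta>hat
  proof -
    have "\<bar>l i x - lhat w i x\<bar> \<le> \<zeta>bar" if "i \<le> m" "x \<in> \<Theta>" for i x
    proof -
      have "\<zeta> i (N i) \<delta> \<le> \<zeta>bar" unfolding \<zeta>bar_def using that by (intro Max_ge) auto
      moreover have "\<bar>l i x - lhat w i x\<bar> \<le> \<zeta> i (N i) \<delta>"
        using w(1) that by (simp add: close_def)
      ultimately show ?thesis by simp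
    qed
    from primal_gap_le[OF sd w(2)[unfolded duality_def] dual dw \<theta>star pw this]
    show "\<bar>primal_value \<Theta> m l - ereal (l 0 \<theta>hat)\<bar>
      \<le> ereal ((2 + max (norm1 m lamstar) (norm1 m lamhat)) * \<zeta>bar
        + max \<alpha>star \<alpha>hat * real m * \<zeta>bar\<^sup>2)" .
    \<comment> \<open>Empirical feasibility and closeness at the index \<open>i\<close> alone give
      its own rate instead of the maximum.\<close>
    show "l i \<theta>hat \<le> \<zeta> i (N i) \<delta>" if "i \<in> {1..m}" for i
    proof -
      have "\<theta>hat \<in> \<Theta>" "lhat w i \<theta>hat \<le> 0"
        using pw that by (auto simp: primal_solution_def feasible_def)
      moreover from this(1) have "\<bar>l i \<theta>hat - lhat w i \<theta>hat\<bar> \<le> \<zeta> i (N i) \<delta>"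
        using w(1) that by (simp add: close_def)
      ultimately show ?thesis by linarith
    qed
  qed
  show ?thesis
  proof (intro conjI)
    show "AE w in M. \<forall>lamhat \<alpha>hat \<theta>hat.
        dual_solution \<Theta> m (lhat w) (lamhat, \<alpha>hat) \<longrightarrow> primal_solution \<Theta> m (lhat w) \<theta>hat \<longrightarrow>
        is_arg_min (\<lambda>\<theta>. aug_lagrangian m (lhat w) \<theta> lamhat \<alpha>hat) (\<lambda>\<theta>. \<theta> \<in> \<Theta>) \<theta>hat"
      using dual_ae unfolding duality_def
      by eventually_elim (blast intro: primal_solution_is_arg_min_aug_lagrangian)
    \<comment> \<open>The cardinality \<open>m + 1\<close> is at most \<open>2 * m + 1\<close>, and
      \<delta> is positive.\<close>
    have "1 - (2 * real m + 1) * \<delta> \<le> 1 - real (card {0..m}) * \<delta>"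
      using \<delta>(1) by (simp add: mult_right_mono)
    with event show "with_prob_ge M (1 - (2 * real m + 1) * \<delta>) (\<lambda>w. \<forall>lamhat \<alpha>hat \<theta>hat.
        dual_solution \<Theta> m (lhat w) (lamhat, \<alpha>hat) \<longrightarrow> primal_solution \<Theta> m (lhat w) \<theta>hat \<longrightarrow>
        (let \<zeta>bar = Max ((\<lambda>i. \<zeta> i (N i) \<delta>) ` {0..m});
             \<Delta>lam = max (norm1 m lamstar) (norm1 m lamhat);
             \<Delta>\<alpha> = max \<alpha>star \<alpha>hat
         in \<bar>primal_value \<Theta> m l - ereal (l 0 \<theta>hat)\<bar>
              \<le> ereal ((2 + \<Delta>lam) * \<zeta>bar + \<Delta>\<alpha> * real m * \<zeta>bar\<^sup>2) \<and>
            (\<forall>i\<in>{1..m}. l i \<theta>hat \<le> \<zeta> i (N i) \<delta>)))"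
      by (rule with_prob_ge_mono) (auto simp: Let_def gap[unfolded \<zeta>bar_def] infeas)
  qed
qed

end
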